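(* Let $G$ be a locally compact totally disconnected topological group with modular function $\Delta:G\to\mathbb{R}^\times_{>0}$. Consider a compact open subgroup $H$ of $G$ and $\mathbf{x}\in G$. Then $$\Delta(\mathbf{x})\cdot|H:H\cap\mathbf{x}^{-1}H\mathbf{x}|=|H:H\cap\mathbf{x}H\mathbf{x}^{-1}|.$$
   Context: The modular function is normalised by $\mu(U\mathbf{x})=\Delta(\mathbf{x})\mu(U)$ for a left Haar measure $\mu$ on $G$ and every Borel set $U$. *)

theory Defs
  imports "HOL-Analysis.Analysis" "HOL-Algebra.Coset"
begin

locale topological_group = group G for G :: "('a, 'b) monoid_scheme" (structure) +
  fixes T :: "'a topology"
  assumes topspace_eq: "topspace T = carrier G"
    and continuous_mult: "continuous_map (prod_topology T T) T (\<lambda>(x, y). x \<otimes> y)"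
    and continuous_inv: "continuous_map T T (\<lambda>x. inv x)"

text \<open>For topological groups this already implies the Hausdorff property: points are closed because
  connected components are, and a \<open>T\<^sub>1\<close> topological group is Hausdorff.\<close>

definition totally_disconnected_space :: "'a topology \<Rightarrow> bool" where
  "totally_disconnected_space T \<longleftrightarrow> (\<forall>x \<in> topspace T. connected_component_of_set T x = {x})"

definition borel_of :: "'a topology \<Rightarrow> 'a measure" where
  "borel_of T = sigma (topspace T) {U. openin T U}"

definition left_haar_measure :: "('a, 'b) monoid_scheme \<Rightarrow> 'a topology \<Rightarrow> 'a measure \<Rightarrow> bool" where
  "left_haar_measure G T \<mu> \<longleftrightarrow>
     sets \<mu> = sets (borel_of T) \<and>
     emeasure \<mu> (carrier G) \<noteq> 0 \<and>
     (\<forall>x \<in> carrier G. \<forall>U \<in> sets \<mu>. emeasure \<mu> (x <#\<^bsub>G\<^esub> U) = emeasure \<mu> U) \<and>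
     (\<forall>K. compactin T K \<longrightarrow> emeasure \<mu> K < \<infinity>) \<and>
     (\<forall>B \<in> sets \<mu>. emeasure \<mu> B = (INF U \<in> {U. openin T U \<and> B \<subseteq> U}. emeasure \<mu> U)) \<and>
     (\<forall>U. openin T U \<longrightarrow> emeasure \<mu> U = (SUP K \<in> {K. compactin T K \<and> K \<subseteq> U}. emeasure \<mu> K))"

text \<open>Some authors use the reciprocal normalisation. By existence and uniqueness (up to scaling) of left
  Haar measure, on a locally compact Hausdorff group exactly one function on the carrier satisfies the
  following, and quantifying over all left Haar measures would give the same function.\<close>

definition modular_function :: "('a, 'b) monoid_scheme \<Rightarrow> 'a topology \<Rightarrow> ('a \<Rightarrow> real) \<Rightarrow> bool" where
  "modular_function G T \<Delta> \<longleftrightarrow>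
     (\<forall>x \<in> carrier G. \<Delta> x > 0) \<and>
     (\<exists>\<mu>. left_haar_measure G T \<mu> \<and>
        (\<forall>x \<in> carrier G. \<forall>U \<in> sets \<mu>.
           emeasure \<mu> (U #>\<^bsub>G\<^esub> x) = ennreal (\<Delta> x) * emeasure \<mu> U))"

text \<open>The junk value 0 for infinite index does not occur for the subgroups
  \<open>H \<inter> x\<inverse>Hx\<close> of a compact open subgroup \<open>H\<close>, see \<open>finite_index_conj\<close> below.\<close>

definition subgroup_index :: "('a, 'b) monoid_scheme \<Rightarrow> 'a set \<Rightarrow> 'a set \<Rightarrow> nat" where
  "subgroup_index G H K = card (rcosets\<^bsub>G\<lparr>carrier := H\<rparr>\<^esub> K)"

context topological_group
begin

lemma continuous_r_translation:
  assumes "a \<in> carrier G"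
  shows "continuous_map T T (\<lambda>x. x \<otimes> a)"
proof -
  have "continuous_map T (prod_topology T T) (\<lambda>x. (x, a))"
    using assms topspace_eq by (simp add: continuous_map_pairwise o_def)
  from continuous_map_compose[OF this continuous_mult] show ?thesis
    by (simp add: o_def)
qed

lemma continuous_l_translation:
  assumes "a \<in> carrier G"
  shows "continuous_map T T (\<lambda>x. a \<otimes> x)"
proof -
  have "continuous_map T (prod_topology T T) (\<lambda>x. (a, x))"
    using assms topspace_eq by (simp add: continuous_map_pairwise o_def)
  from continuous_map_compose[OF this continuous_mult] show ?thesis
    by (simp add: o_def)
qed

lemma openin_r_coset:
  assumes "openin T K" "a \<in> carrier G"
  shows "openin T (K #> a)"
proof -
  have K: "K \<subseteq> carrier G"
    using assms(1) openin_subset topspace_eq by blast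
  have "K #> a = {x \<in> topspace T. x \<otimes> inv a \<in> K}"
  proof (intro equalityI subsetI)
    fix x assume "x \<in> K #> a"
    then obtain k where "k \<in> K" "x = k \<otimes> a" by (auto simp: r_coset_def)
    then show "x \<in> {x \<in> topspace T. x \<otimes> inv a \<in> K}"
      using K assms(2) by (auto simp: topspace_eq m_assoc subset_iff)
  next
    fix x assume x: "x \<in> {x \<in> topspace T. x \<otimes> inv a \<in> K}"
    then have "x = (x \<otimes> inv a) \<otimes> a"
      using assms(2) by (simp add: topspace_eq m_assoc)
    then show "x \<in> K #> a" using x by (auto simp: r_coset_def)
  qed
  then show ?thesis
    using openin_continuous_map_preimage[OF continuous_r_translation assms(1), of "inv a"] assms(2)
    by simp
qed

lemma finite_rcosets:
  assumes H: "subgroup H G" "compactin T H" and K: "subgroup K G" "openin T K"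
  shows "finite (rcosets\<^bsub>G\<lparr>carrier := H\<rparr>\<^esub> K)"
proof -
  have Hc: "H \<subseteq> carrier G" using H(1) by (rule subgroup.subset)
  let ?U = "(\<lambda>h. K #> h) ` H"
  have mem: "h \<in> K #> h" if "h \<in> H" for h
    using that Hc K(1) rcos_self by blast
  have "\<forall>V \<in> ?U. openin T V" "H \<subseteq> \<Union>?U"
    using Hc K(2) openin_r_coset mem by auto
  then obtain F where F: "finite F" "F \<subseteq> ?U" "H \<subseteq> \<Union>F"
    using H(2) unfolding compactin_def by meson
  have "?U \<subseteq> F"
  proof
    fix V assume "V \<in> ?U"
    then obtain h where h: "h \<in> H" "V = K #> h" by blast
    from F(3) h(1) obtain W where W: "W \<in> F" "h \<in> W"
      by (meson UnionE subsetD)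
    with F(2) obtain h' where h': "h' \<in> H" "W = K #> h'"
      by (meson imageE subsetD)
    have "K #> h' = K #> h"
      using repr_independence[of h K h'] h' W(2) Hc K(1) by auto
    with h h' W(1) show "V \<in> F" by simp
  qed
  with F(1) have "finite ?U" by (rule finite_subset[rotated])
  moreover have "rcosets\<^bsub>G\<lparr>carrier := H\<rparr>\<^esub> K = ?U"
    by (auto simp: RCOSETS_def r_coset_def)
  ultimately show ?thesis by simp
qed

lemma cancel_inv:
  assumes "a \<in> carrier G" "b \<in> carrier G"
  shows "inv a \<otimes> (a \<otimes> b) = b" and "a \<otimes> (inv a \<otimes> b) = b"
  using assms by (simp_all add: m_assoc[symmetric])

lemma conj_eq:
  assumes "H \<subseteq> carrier G" "x \<in> carrier G"
  shows "inv x <# H #> x = {y \<in> carrier G. x \<otimes> y \<otimes> inv x \<in> H}"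
proof (intro equalityI subsetI)
  fix y assume "y \<in> inv x <# H #> x"
  then obtain h where h: "h \<in> H" "y = inv x \<otimes> h \<otimes> x"
    by (auto simp: l_coset_def r_coset_def)
  then have hc: "h \<in> carrier G" using assms by blast
  have "x \<otimes> y \<otimes> inv x = (x \<otimes> inv x) \<otimes> h \<otimes> (x \<otimes> inv x)"
    using h(2) hc assms(2) by (simp add: m_assoc cancel_inv)
  then show "y \<in> {y \<in> carrier G. x \<otimes> y \<otimes> inv x \<in> H}"
    using h hc assms(2) by simp
next
  fix y assume y: "y \<in> {y \<in> carrier G. x \<otimes> y \<otimes> inv x \<in> H}"
  then have "(inv x \<otimes> x) \<otimes> y \<otimes> (inv x \<otimes> x) = inv x \<otimes> (x \<otimes> y \<otimes> inv x) \<otimes> x"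
    using assms(2) by (simp add: m_assoc cancel_inv)
  then have "y = inv x \<otimes> (x \<otimes> y \<otimes> inv x) \<otimes> x"
    using y assms(2) by simp
  then show "y \<in> inv x <# H #> x"
    using y unfolding l_coset_def r_coset_def by blast
qed

lemma subgroup_conj:
  assumes "subgroup H G" "x \<in> carrier G"
  shows "subgroup (inv x <# H #> x) G"
proof -
  interpret H: subgroup H G by fact
  have eq: "inv x <# H #> x = {y \<in> carrier G. x \<otimes> y \<otimes> inv x \<in> H}"
    using conj_eq[OF H.subset assms(2)] .
  show ?thesis unfolding eq
  proof
    show "{y \<in> carrier G. x \<otimes> y \<otimes> inv x \<in> H} \<subseteq> carrier G" by blast
    show "\<one> \<in> {y \<in> carrier G. x \<otimes> y \<otimes> inv x \<in> H}" using assms(2) by simp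
  next
    fix y z assume *: "y \<in> {y \<in> carrier G. x \<otimes> y \<otimes> inv x \<in> H}"
      "z \<in> {y \<in> carrier G. x \<otimes> y \<otimes> inv x \<in> H}"
    have "(x \<otimes> y \<otimes> inv x) \<otimes> (x \<otimes> z \<otimes> inv x) = x \<otimes> y \<otimes> (inv x \<otimes> x) \<otimes> z \<otimes> inv x"
      using * assms(2) by (simp add: m_assoc cancel_inv)
    also have "\<dots> = x \<otimes> (y \<otimes> z) \<otimes> inv x" using * assms(2) by (simp add: m_assoc)
    finally show "y \<otimes> z \<in> {y \<in> carrier G. x \<otimes> y \<otimes> inv x \<in> H}"
      using * H.m_closed by (metis (mono_tags, lifting) m_closed mem_Collect_eq)
  next
    fix y assume *: "y \<in> {y \<in> carrier G. x \<otimes> y \<otimes> inv x \<in> H}"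
    have "inv (x \<otimes> y \<otimes> inv x) = x \<otimes> inv y \<otimes> inv x"
      using * assms(2) by (simp add: inv_mult_group m_assoc)
    then show "inv y \<in> {y \<in> carrier G. x \<otimes> y \<otimes> inv x \<in> H}"
      using * H.m_inv_closed by (metis (mono_tags, lifting) inv_closed mem_Collect_eq)
  qed
qed

lemma openin_conj:
  assumes "openin T H" "x \<in> carrier G"
  shows "openin T (inv x <# H #> x)"
proof -
  have H: "H \<subseteq> carrier G" using assms(1) openin_subset topspace_eq by blast
  have "continuous_map T T (\<lambda>y. x \<otimes> y \<otimes> inv x)"
    using continuous_map_compose[OF continuous_l_translation[OF assms(2)]
        continuous_r_translation[of "inv x"]] assms(2) by (simp add: o_def)
  from openin_continuous_map_preimage[OF this assms(1)] show ?thesis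
    by (simp add: conj_eq[OF H assms(2)] topspace_eq)
qed

lemma finite_index_conj:
  assumes "subgroup H G" "compactin T H" "openin T H" "x \<in> carrier G"
  shows "finite (rcosets\<^bsub>G\<lparr>carrier := H\<rparr>\<^esub> (H \<inter> (inv x <# H #> x)))"
proof (rule finite_rcosets[OF assms(1,2)])
  show "subgroup (H \<inter> (inv x <# H #> x)) G"
    using assms(1,4) by (intro subgroups_Inter_pair subgroup_conj)
  show "openin T (H \<inter> (inv x <# H #> x))"
    using assms(3,4) by (intro openin_Int openin_conj)
qed

end

end

theory Submission
  imports Defs
begin

text \<open>Let \<open>K = H \<inter> x\<inverse>Hx\<close> and \<open>L = H \<inter> xHx\<inverse>\<close>, so that \<open>K = x\<inverse>Lx\<close>. For a left Haar
  measure \<open>\<mu>\<close>, splitting \<open>H\<close> into left cosets gives \<open>\<mu> H = |H:K| \<mu> K = |H:L| \<mu> L\<close>, while left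
  invariance gives \<open>\<mu> K = \<mu> (Lx) = \<Delta> x \<mu> L\<close>. Since \<open>0 < \<mu> L < \<infinity>\<close>, the factor \<open>\<mu> L\<close> cancels.\<close>

lemma sets_borel_of_openin:
  assumes "openin T U"
  shows "U \<in> sets (borel_of T)"
proof -
  have "{U. openin T U} \<subseteq> Pow (topspace T)"
    using openin_subset by blast
  then show ?thesis
    using assms by (simp add: borel_of_def sets_measure_of sigma_sets.Basic)
qed

lemma left_haar_measureD:
  assumes "left_haar_measure G T \<mu>"
  shows left_haar_measure_sets: "sets \<mu> = sets (borel_of T)"
    and left_haar_measure_nonzero: "emeasure \<mu> (carrier G) \<noteq> 0"
    and left_haar_measure_l_coset:
      "\<And>a U. a \<in> carrier G \<Longrightarrow> U \<in> sets \<mu> \<Longrightarrow> emeasure \<mu> (a <#\<^bsub>G\<^esub> U) = emeasure \<mu> U"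
    and left_haar_measure_compact: "\<And>C. compactin T C \<Longrightarrow> emeasure \<mu> C < \<infinity>"
    and left_haar_measure_inner_regular:
      "\<And>U. openin T U \<Longrightarrow> emeasure \<mu> U = (SUP C \<in> {C. compactin T C \<and> C \<subseteq> U}. emeasure \<mu> C)"
  using assms unfolding left_haar_measure_def by (elim conjE, blast)+

lemma left_haar_measure_openin:
  assumes "left_haar_measure G T \<mu>" "openin T U"
  shows "U \<in> sets \<mu>"
  using sets_borel_of_openin[OF assms(2)] left_haar_measure_sets[OF assms(1)] by simp

context topological_group
begin

text \<open>This presents the coset as the preimage of \<open>K\<close> under left translation by
  \<open>inv a\<close>, the form in which continuity of translations makes it open.\<close>

lemma l_coset_eq:
  assumes "K \<subseteq> carrier G" "a \<in> carrier G"
  shows "a <# K = {y \<in> carrier G. inv a \<otimes> y \<in> K}"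
proof (intro equalityI subsetI)
  fix y assume "y \<in> a <# K"
  then obtain k where "k \<in> K" "y = a \<otimes> k" by (auto simp: l_coset_def)
  then show "y \<in> {y \<in> carrier G. inv a \<otimes> y \<in> K}"
    using assms cancel_inv by auto
next
  fix y assume y: "y \<in> {y \<in> carrier G. inv a \<otimes> y \<in> K}"
  then have "y = a \<otimes> (inv a \<otimes> y)"
    using assms cancel_inv by auto
  then show "y \<in> a <# K" using y by (auto simp: l_coset_def)
qed

lemma openin_l_coset:
  assumes "openin T K" "a \<in> carrier G"
  shows "openin T (a <# K)"
proof -
  have K: "K \<subseteq> carrier G"
    using assms(1) openin_subset topspace_eq by blast
  show ?thesis
    using openin_continuous_map_preimage[OF continuous_l_translation assms(1), of "inv a"] assms(2)
    by (simp add: l_coset_eq[OF K assms(2)] topspace_eq)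
qed

lemma inv_image_subgroup:
  assumes "subgroup K G"
  shows "m_inv G ` K = K"
proof (intro equalityI subsetI)
  interpret K: subgroup K G by fact
  show "k \<in> K" if "k \<in> m_inv G ` K" for k
    using that by blast
  show "k \<in> m_inv G ` K" if k: "k \<in> K" for k
  proof (rule image_eqI)
    show "k = inv (inv k)" using k by simp
    show "inv k \<in> K" using k by simp
  qed
qed

text \<open>Inversion reverses products, so \<open>k \<otimes> h\<close> goes to
  \<open>inv h \<otimes> inv k\<close>, and \<open>inv k\<close> runs over \<open>K\<close> again
  because \<open>K\<close> is a subgroup.\<close>

lemma inv_image_r_coset:
  assumes "subgroup K G" "h \<in> carrier G"
  shows "m_inv G ` (K #> h) = inv h <# K"
proof -
  interpret K: subgroup K G by fact
  have "m_inv G ` (K #> h) = (\<lambda>k. inv h \<otimes> inv k) ` K"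
  proof -
    have "K #> h = (\<lambda>k. k \<otimes> h) ` K" by (auto simp: r_coset_def)
    then show ?thesis
      using assms(2) K.mem_carrier by (simp add: image_image inv_mult_group cong: image_cong)
  qed
  also have "\<dots> = (\<lambda>k. inv h \<otimes> k) ` m_inv G ` K"
    by (simp only: image_image)
  also have "m_inv G ` K = K"
    using inv_image_subgroup[OF assms(1)] .
  finally show ?thesis by (auto simp: l_coset_def)
qed

text \<open>The index counts right cosets, whereas \<open>\<mu>\<close> is invariant under left translation; inversion
  turns the former into left cosets.\<close>

lemma emeasure_eq_index_mult:
  assumes \<mu>: "left_haar_measure G T \<mu>"
    and H: "subgroup H G" "compactin T H"
    and K: "subgroup K G" "openin T K" "K \<subseteq> H"
  shows "emeasure \<mu> H = of_nat (subgroup_index G H K) * emeasure \<mu> K"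
proof -
  let ?R = "rcosets\<^bsub>G\<lparr>carrier := H\<rparr>\<^esub> K"
  interpret H: subgroup H G by fact
  interpret GH: group "G\<lparr>carrier := H\<rparr>"
    using H(1) by (rule subgroup_imp_group)
  have KH: "subgroup K (G\<lparr>carrier := H\<rparr>)"
    using subgroup_incl[OF K(1) H(1) K(3)] .
  have rcosets: "?R = (\<lambda>h. K #> h) ` H"
    by (auto simp: RCOSETS_def r_coset_def)
  have Ksets: "K \<in> sets \<mu>"
    using left_haar_measure_openin[OF \<mu> K(2)] .
  have coset: "m_inv G ` C \<in> sets \<mu>" "emeasure \<mu> (m_inv G ` C) = emeasure \<mu> K" if "C \<in> ?R" for C
  proof -
    from that obtain h where h: "h \<in> H" "C = K #> h" unfolding rcosets by blast
    then have eq: "m_inv G ` C = inv h <# K" and hc: "inv h \<in> carrier G"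
      using inv_image_r_coset[OF K(1)] by auto
    show "m_inv G ` C \<in> sets \<mu>"
      unfolding eq using left_haar_measure_openin[OF \<mu> openin_l_coset[OF K(2) hc]] .
    show "emeasure \<mu> (m_inv G ` C) = emeasure \<mu> K"
      unfolding eq using left_haar_measure_l_coset[OF \<mu> hc Ksets] .
  qed
  have part: "\<Union>?R = H" using GH.rcosets_part_G[OF KH] by simp
  \<comment> \<open>Distinct right cosets are disjoint, and injectivity of inversion on the carrier
    keeps their images disjoint.\<close>
  have "disjoint_family_on (\<lambda>C. m_inv G ` C) ?R"
    unfolding disjoint_family_on_def
  proof (intro ballI impI)
    fix C D assume CD: "C \<in> ?R" "D \<in> ?R" "C \<noteq> D"
    then have "C \<inter> D = {}"
      using GH.rcos_disjoint[OF KH] by (auto simp: pairwise_def disjnt_def)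
    moreover have "C \<subseteq> carrier G" "D \<subseteq> carrier G"
      using CD part H.subset by blast+
    ultimately show "m_inv G ` C \<inter> m_inv G ` D = {}"
      using inj_on_image_Int[OF inv_inj, of C D] by simp
  qed
  \<comment> \<open>Compactness of \<open>H\<close> and openness of \<open>K\<close> make the set of
    cosets finite. Hence finite additivity applies, and the \<open>card\<close> in
    \<open>subgroup_index\<close> is the true index, not the default 0 of an infinite set.\<close>
  then have "emeasure \<mu> (\<Union>C\<in>?R. m_inv G ` C) = (\<Sum>C\<in>?R. emeasure \<mu> (m_inv G ` C))"
    using coset(1) finite_rcosets[OF H K(1,2)] by (intro sum_emeasure[symmetric]) auto
  also have "\<dots> = of_nat (subgroup_index G H K) * emeasure \<mu> K"
    using coset(2) by (simp add: subgroup_index_def)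
  \<comment> \<open>The right cosets fill \<open>H\<close>, and \<open>H\<close> is stable under
    inversion, so the inverted cosets fill \<open>H\<close> as well.\<close>
  also have "(\<Union>C\<in>?R. m_inv G ` C) = m_inv G ` H"
    using part by (metis image_Union)
  also have "\<dots> = H"
    using inv_image_subgroup[OF H(1)] .
  finally show ?thesis .
qed

text \<open>If \<open>U\<close> were null, so would be all its left translates. These are open and
  cover the group, so every compact set lies in a finite union of them and is null. Inner regularity
  on the open set \<open>carrier G\<close> would then make the whole group null.\<close>

lemma haar_emeasure_open_nonzero:
  assumes \<mu>: "left_haar_measure G T \<mu>" and U: "openin T U" "U \<noteq> {}"
  shows "emeasure \<mu> U \<noteq> 0"
proof
  assume null: "emeasure \<mu> U = 0"
  note sets = left_haar_measure_openin[OF \<mu>]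
  have Uc: "U \<subseteq> carrier G" using U(1) openin_subset topspace_eq by blast
  obtain u where u: "u \<in> U" using U(2) by blast
  let ?\<F> = "(\<lambda>a. a <# U) ` carrier G"
  have cover: "carrier G \<subseteq> \<Union>?\<F>"
  proof
    fix g assume g: "g \<in> carrier G"
    have uc: "u \<in> carrier G" using u Uc by blast
    \<comment> \<open>Left translation by \<open>g \<otimes> inv u\<close> carries the chosen point
      \<open>u\<close> of \<open>U\<close> to \<open>g\<close>.\<close>
    have "g = (g \<otimes> inv u) \<otimes> u" using g uc by (simp add: m_assoc)
    then have "g \<in> (g \<otimes> inv u) <# U" using u unfolding l_coset_def by blast
    moreover have "g \<otimes> inv u \<in> carrier G" using g uc by simp
    ultimately show "g \<in> \<Union>?\<F>" by (rule UN_I[rotated])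
  qed
  have compact_null: "emeasure \<mu> C = 0" if C: "compactin T C" for C
  proof -
    have "C \<subseteq> \<Union>?\<F>" using compactin_subset_topspace[OF C] cover topspace_eq by auto
    moreover have "\<forall>V\<in>?\<F>. openin T V" using openin_l_coset[OF U(1)] by simp
    ultimately have "\<exists>\<G>. finite \<G> \<and> \<G> \<subseteq> ?\<F> \<and> C \<subseteq> \<Union>\<G>"
      using C[unfolded compactin_def, THEN conjunct2, rule_format, of ?\<F>] by simp
    then obtain \<G> where \<G>: "finite \<G>" "\<G> \<subseteq> ?\<F>" "C \<subseteq> \<Union>\<G>"
      by (elim exE conjE) (rule that)
    have "V \<in> null_sets \<mu>" if V: "V \<in> \<G>" for V
    proof -
      obtain a where a: "V = a <# U" "a \<in> carrier G" using subsetD[OF \<G>(2) V] by (rule imageE)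
      have "emeasure \<mu> V = emeasure \<mu> U"
        using left_haar_measure_l_coset[OF \<mu> a(2) sets[OF U(1)]] a(1) by simp
      then show ?thesis
        using null sets[OF openin_l_coset[OF U(1) a(2)]] a(1) by (simp add: null_sets_def)
    qed
    then have "\<Union>\<G> \<in> null_sets \<mu>"
      using null_sets.finite_Union[OF \<G>(1)] by blast
    then show ?thesis
      using \<G>(3) emeasure_mono[of C "\<Union>\<G>" \<mu>] by (auto simp: null_sets_def)
  qed
  have "openin T (carrier G)" using openin_topspace[of T] by (simp add: topspace_eq)
  then have "emeasure \<mu> (carrier G) = (SUP C \<in> {C. compactin T C \<and> C \<subseteq> carrier G}. emeasure \<mu> C)"
    by (rule left_haar_measure_inner_regular[OF \<mu>])
  also have "\<dots> = 0"
    by (metis (no_types, lifting) SUP_least compact_null le_zero_eq mem_Collect_eq order_refl)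
  finally show False using left_haar_measure_nonzero[OF \<mu>] by simp
qed

text \<open>Conjugation by \<open>inv x\<close> exchanges the two conditions that define the
  intersection. The brackets put the right translation by \<open>x\<close> innermost: \<Delta>
  governs that one, and left invariance then absorbs \<open>inv x\<close>.\<close>

lemma l_coset_r_coset_conj_Int:
  assumes H: "H \<subseteq> carrier G" and x: "x \<in> carrier G"
  shows "inv x <# ((H \<inter> (x <# H #> inv x)) #> x) = H \<inter> (inv x <# H #> x)"
proof -
  have L: "H \<inter> (x <# H #> inv x) = {y \<in> H. inv x \<otimes> y \<otimes> x \<in> H}"
    using conj_eq[OF H, of "inv x"] x H by auto
  have "H \<inter> (x <# H #> inv x) \<subseteq> carrier G" using H by blast
  then have "inv x <# (H \<inter> (x <# H #> inv x)) #> x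
      = {y \<in> carrier G. x \<otimes> y \<otimes> inv x \<in> {y \<in> H. inv x \<otimes> y \<otimes> x \<in> H}}"
    using conj_eq x L by simp
  \<comment> \<open>With \<open>x \<otimes> y \<otimes> inv x\<close> in place of \<open>y\<close>,
    the inner conjugation by \<open>inv x\<close> undoes the one by \<open>x\<close> and leaves the
    condition that \<open>y\<close> is in \<open>H\<close>.\<close>
  also have "\<dots> = {y \<in> carrier G. x \<otimes> y \<otimes> inv x \<in> H \<and> y \<in> H}"
    using x by (auto simp: m_assoc cancel_inv)
  also have "\<dots> = H \<inter> (inv x <# H #> x)"
    using conj_eq[OF H x] H by auto
  finally show ?thesis
    using x H \<open>H \<inter> (x <# H #> inv x) \<subseteq> carrier G\<close> by (simp add: coset_assoc)
qed

end

theorem proposition1p2: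
  fixes G :: "('a, 'b) monoid_scheme" (structure)
    and T :: "'a topology"
    and \<Delta> :: "'a \<Rightarrow> real"
  assumes "topological_group G T"
    and "locally_compact_space T"
    and "totally_disconnected_space T"
    and "modular_function G T \<Delta>"
    and "subgroup H G" and "compactin T H" and "openin T H"
    and "x \<in> carrier G"
  shows "\<Delta> x * real (subgroup_index G H (H \<inter> (inv x <# H #> x)))
       = real (subgroup_index G H (H \<inter> (x <# H #> inv x)))"
proof -
  interpret topological_group G T by fact
  note H = assms(5-7) and x = assms(8)
  let ?K = "H \<inter> (inv x <# H #> x)" and ?L = "H \<inter> (x <# H #> inv x)"
  let ?m = "subgroup_index G H ?K" and ?n = "subgroup_index G H ?L"
  obtain \<mu> where \<mu>: "left_haar_measure G T \<mu>"
    and \<Delta>: "\<And>U. U \<in> sets \<mu> \<Longrightarrow> emeasure \<mu> (U #> x) = ennreal (\<Delta> x) * emeasure \<mu> U"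
    and pos: "\<Delta> x > 0"
    using assms(4) x unfolding modular_function_def by blast
  note sets = left_haar_measure_openin[OF \<mu>]
  have K: "subgroup ?K G" "openin T ?K"
    using H x by (auto intro: subgroups_Inter_pair subgroup_conj openin_conj)
  have L: "subgroup ?L G" "openin T ?L"
    using H x subgroup_conj[of H "inv x"] openin_conj[of H "inv x"]
    by (auto intro: subgroups_Inter_pair)
  have Lx: "openin T (?L #> x)" using openin_r_coset[OF L(2) x] .
  have "emeasure \<mu> ?K = emeasure \<mu> (inv x <# (?L #> x))"
    using l_coset_r_coset_conj_Int[OF subgroup.subset[OF H(1)] x] by simp
  also have "\<dots> = emeasure \<mu> (?L #> x)"
    using left_haar_measure_l_coset[OF \<mu> inv_closed[OF x] sets[OF Lx]] .
  also have "\<dots> = ennreal (\<Delta> x) * emeasure \<mu> ?L"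
    using \<Delta> sets[OF L(2)] .
  finally have \<mu>K: "emeasure \<mu> ?K = ennreal (\<Delta> x) * emeasure \<mu> ?L" .
  \<comment> \<open>Both products equal the measure of \<open>H\<close>.\<close>
  have "of_nat ?m * emeasure \<mu> ?K = of_nat ?n * emeasure \<mu> ?L"
    using emeasure_eq_index_mult[OF \<mu> H(1,2) K] emeasure_eq_index_mult[OF \<mu> H(1,2) L] by simp
  then have "ennreal (\<Delta> x * real ?m) * emeasure \<mu> ?L = ennreal (real ?n) * emeasure \<mu> ?L"
    using pos by (simp add: \<mu>K ennreal_mult ennreal_of_nat_eq_real_of_nat mult_ac)
  \<comment> \<open>Cancelling a factor in \<open>ennreal\<close> requires it to be neither 0 nor
    infinite. The first holds because \<open>?L\<close> is open and contains the identity, the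
    second because \<open>?L\<close> lies in the compact set \<open>H\<close>.\<close>
  moreover have "emeasure \<mu> ?L \<noteq> 0"
    using haar_emeasure_open_nonzero[OF \<mu> L(2)] subgroup.one_closed[OF L(1)] by blast
  moreover have "emeasure \<mu> ?L < \<infinity>"
  proof -
    have "emeasure \<mu> ?L \<le> emeasure \<mu> H" using sets[OF H(3)] by (intro emeasure_mono) auto
    also have "\<dots> < \<infinity>" using left_haar_measure_compact[OF \<mu> H(2)] .
    finally show ?thesis .
  qed
  ultimately have "ennreal (\<Delta> x * real ?m) = ennreal (real ?n)"
    by (simp add: mult.commute[of _ "emeasure \<mu> ?L"] ennreal_mult_cancel_left less_top[symmetric])
  \<comment> \<open>\<open>ennreal\<close> sends all negative reals to 0, so it is injective only on
    nonnegative arguments; positivity of \<open>\<Delta> x\<close> secures this on the left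
    side.\<close>
  then show ?thesis
    using pos by (subst (asm) ennreal_inj) auto
qed

end
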